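(* For every fixed $d\geq 1$, the number of $U(d+1)$-free graphs on $N$ labeled vertices is at most $2^{O(N^{2-1/d}\log N)}$.
   Context: The universal graph $U(k)$ is the bipartite graph with color classes $A$ and $B=2^A$ where $|A|=k$, with $\{a,b\}$ an edge iff $a\in b$. A (simple, not necessarily bipartite) graph $G=(V,E)$ is $U(k)$-free if for every two disjoint sets $A,B\subset V$ with $|A|=k$ and $|B|=2^k$, the bipartite graph formed by the edges of $G$ between $A$ and $B$ is not isomorphic to $U(k)$. *)

theory Defs
  imports
    "HOL-Library.Landau_Symbols"
    "Graph_Theory.Pair_Digraph"
    "Graph_Theory.Digraph_Isomorphism"
begin

text \<open>
  A finite simple undirected graph is a \<^const>\<open>pair_graph\<close>: a finite vertex set with a
  symmetric, irreflexive set of arcs, so that the edge \<open>{u, v}\<close> is the pair of arcs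
  \<open>(u, v)\<close> and \<open>(v, u)\<close>. Isomorphism of such graphs is \<^const>\<open>digraph_iso\<close> of the
  underlying digraphs.
\<close>

definition universal_graph :: "nat \<Rightarrow> (nat + nat set) pair_pre_digraph" where
  "universal_graph k =
    \<lparr> pverts = Inl ` {..<k} \<union> Inr ` Pow {..<k},
      parcs = {(Inl a, Inr b) | a b. b \<subseteq> {..<k} \<and> a \<in> b}
            \<union> {(Inr b, Inl a) | a b. b \<subseteq> {..<k} \<and> a \<in> b} \<rparr>"

definition between_graph ::
    "'a pair_pre_digraph \<Rightarrow> 'a set \<Rightarrow> 'a set \<Rightarrow> 'a pair_pre_digraph" where
  "between_graph G A B =
    \<lparr> pverts = A \<union> B, parcs = parcs G \<inter> (A \<times> B \<union> B \<times> A) \<rparr>"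

definition universal_free :: "nat \<Rightarrow> 'a pair_pre_digraph \<Rightarrow> bool" where
  "universal_free k G \<longleftrightarrow>
    (\<forall>A B. A \<subseteq> pverts G \<and> B \<subseteq> pverts G \<and> A \<inter> B = {} \<and> card A = k \<and> card B = 2 ^ k \<longrightarrow>
      \<not> digraph_iso (with_proj (between_graph G A B)) (with_proj (universal_graph k)))"

definition universal_free_graphs :: "nat \<Rightarrow> nat \<Rightarrow> nat pair_pre_digraph set" where
  "universal_free_graphs k N = {G. pair_graph G \<and> pverts G = {..<N} \<and> universal_free k G}"

lemma pair_graph_universal_graph: "pair_graph (universal_graph k)"
proof -
  have fin: "finite (pverts (universal_graph k))"
    by (simp add: universal_graph_def)
  have sub: "parcs (universal_graph k) \<subseteq> pverts (universal_graph k) \<times> pverts (universal_graph k)"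
    by (auto simp: universal_graph_def)
  have "finite (parcs (universal_graph k))"
    using finite_subset[OF sub] fin by blast
  moreover have "symmetric (with_proj (universal_graph k))"
    by (auto simp: symmetric_def universal_graph_def intro!: symI)
  ultimately show ?thesis
    using fin sub by unfold_locales (auto simp: universal_graph_def)
qed

lemma finite_universal_free_graphs: "finite (universal_free_graphs k N)"
proof (rule finite_subset)
  show "universal_free_graphs k N \<subseteq>
      (\<lambda>E. \<lparr>pverts = {..<N}, parcs = E\<rparr>) ` Pow ({..<N} \<times> {..<N})"
  proof
    fix G assume G: "G \<in> universal_free_graphs k N"
    then interpret pair_graph G by (simp add: universal_free_graphs_def)
    have V: "pverts G = {..<N}" using G by (simp add: universal_free_graphs_def)
    have "parcs G \<subseteq> {..<N} \<times> {..<N}"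
      using in_arcsD1 in_arcsD2 V by auto
    moreover have "G = \<lparr>pverts = {..<N}, parcs = parcs G\<rparr>"
      using V by simp
    ultimately show "G \<in> (\<lambda>E. \<lparr>pverts = {..<N}, parcs = E\<rparr>) ` Pow ({..<N} \<times> {..<N})"
      by blast
  qed
qed simp

end

theory Submission
  imports Defs
begin

text \<open>
  Say that \<open>S\<close> is shattered if every subset of \<open>S\<close> is the neighbourhood in \<open>S\<close> of a vertex
  outside \<open>S\<close>; a \<open>U(d+1)\<close>-free graph shatters no set of size \<open>d + 1\<close>. Haussler's packing
  argument then gives two distinct vertices \<open>u, v\<close> whose neighbourhoods differ, apart from \<open>u\<close> and
  \<open>v\<close>, in only \<open>O(n powr (1 - 1/d))\<close> places, where \<open>n\<close> is the number of vertices. Deleting \<open>v\<close>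
  leaves a \<open>U(d+1)\<close>-free graph from which the original one is recovered by naming \<open>u\<close>, \<open>v\<close> and the
  few differences, i.e. with \<open>O(n powr (1 - 1/d) * ln n)\<close> bits. Iterating over the \<open>N\<close> vertices
  costs \<open>O(N powr (2 - 1/d) * ln N)\<close> bits in total. Deleting row and column together keeps this bound
  for \<open>d = 1\<close>, where deleting rows only would lose a factor \<open>ln N\<close>.
\<close>

section \<open>Set systems of bounded VC dimension\<close>

definition shatters :: "'a set set \<Rightarrow> 'a set \<Rightarrow> bool" where
  "shatters F S \<longleftrightarrow> (\<forall>T\<subseteq>S. \<exists>Q\<in>F. Q \<inter> S = T)"

text \<open>The strict inequality gives \<open>k = 0\<close> a meaning: any nonempty family shatters
  the empty set, so only the empty family qualifies. Inductions that lower the dimension can end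
  there.\<close>

definition vc_less :: "nat \<Rightarrow> 'a set \<Rightarrow> 'a set set \<Rightarrow> bool" where
  "vc_less k A F \<longleftrightarrow> (\<forall>S\<subseteq>A. shatters F S \<longrightarrow> card S < k)"

text \<open>These are the edges of direction \<open>x\<close> in the one-inclusion graph of
  \<open>F\<close>, the subgraph of the hypercube induced by \<open>F\<close>. Each edge is
  represented by its lower endpoint.\<close>

definition cube_edges :: "'a \<Rightarrow> 'a set set \<Rightarrow> 'a set set" where
  "cube_edges x F = {Q \<in> F. x \<notin> Q \<and> insert x Q \<in> F}"

lemma shatters_mono: "shatters F S \<Longrightarrow> F \<subseteq> F' \<Longrightarrow> shatters F' S"
  unfolding shatters_def by (meson subsetD)

lemma shatters_subset:
  assumes "shatters F S" "S' \<subseteq> S"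
  shows "shatters F S'"
  unfolding shatters_def
proof (intro allI impI)
  fix T assume T: "T \<subseteq> S'"
  then obtain Q where "Q \<in> F" "Q \<inter> S = T"
    using assms unfolding shatters_def by (meson subset_trans)
  then show "\<exists>Q\<in>F. Q \<inter> S' = T" using T assms(2) by blast
qed

lemma vc_less_mono: "vc_less k A F \<Longrightarrow> F' \<subseteq> F \<Longrightarrow> vc_less k A F'"
  unfolding vc_less_def using shatters_mono by blast

lemma vc_less_0_iff: "vc_less 0 A F \<longleftrightarrow> F = {}"
  by (auto simp: vc_less_def shatters_def)

section \<open>Splitting a family at one element of the ground set\<close>

context
  fixes F :: "'a set set" and A :: "'a set" and x :: 'a
  assumes fin: "finite A" and x: "x \<notin> A" and F: "F \<subseteq> Pow (insert x A)"
begin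

definition without_x :: "'a set set" where "without_x = {Q \<in> F. x \<notin> Q}"
definition link_x :: "'a set set" where "link_x = {Q. x \<notin> Q \<and> insert x Q \<in> F}"

lemma F_split: "F = without_x \<union> insert x ` link_x"
proof -
  have "Q \<in> insert x ` link_x" if "Q \<in> F" "x \<in> Q" for Q
    using that by (intro image_eqI[of _ _ "Q - {x}"]) (auto simp: link_x_def insert_absorb)
  then show ?thesis by (auto simp: without_x_def link_x_def)
qed

lemma parts_subset: "without_x \<subseteq> Pow A" "link_x \<subseteq> Pow A"
  using F x by (auto simp: without_x_def link_x_def)

lemma finite_parts: "finite without_x" "finite link_x"
  using finite_subset[OF parts_subset(1)] finite_subset[OF parts_subset(2)] fin by simp_all

lemma inj_insert_x: "inj_on (insert x) link_x"
  by (rule inj_onI) (simp add: link_x_def insert_ident)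

text \<open>Erasing \<open>x\<close> maps \<open>F\<close> onto the union of the two parts. Exactly
  the sets in the intersection have two preimages.\<close>

lemma card_F: "card F = card (without_x \<union> link_x) + card (without_x \<inter> link_x)"
proof -
  have "card F = card without_x + card (insert x ` link_x)"
    by (subst F_split, rule card_Un_disjoint) (simp_all add: finite_parts, auto simp: without_x_def)
  then show ?thesis
    using card_Un_Int[OF finite_parts] by (simp add: card_image[OF inj_insert_x])
qed

text \<open>An edge of direction \<open>y\<close> does not change membership of \<open>x\<close>, so
  it lies within one of the two parts. By inclusion-exclusion, edges present in both parts are edges
  of the intersection, and edges present in either are edges of the union.\<close>

lemma card_cube_edges_F:
  assumes "y \<in> A"
  shows "card (cube_edges y F) \<le>
    card (cube_edges y (without_x \<union> link_x)) + card (cube_edges y (without_x \<inter> link_x))"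
proof -
  have yx: "y \<noteq> x" using assms x by auto
  have eq: "cube_edges y F = cube_edges y without_x \<union> insert x ` cube_edges y link_x"
  proof -
    have "Q \<in> insert x ` cube_edges y link_x"
      if "Q \<in> F" "y \<notin> Q" "insert y Q \<in> F" "x \<in> Q" for Q
    proof (rule image_eqI[of _ _ "Q - {x}"])
      have "insert x (insert y (Q - {x})) = insert y Q" using that by auto
      then show "Q - {x} \<in> cube_edges y link_x"
        using that yx by (auto simp: cube_edges_def link_x_def insert_absorb)
    qed (use that in auto)
    then show ?thesis
      using yx by (auto simp: cube_edges_def without_x_def link_x_def insert_commute)
  qed
  have fin': "finite (cube_edges y without_x)" "finite (cube_edges y link_x)"
      "finite (cube_edges y (without_x \<union> link_x))"
    using finite_parts by (auto simp: cube_edges_def)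
  have "card (cube_edges y F) \<le> card (cube_edges y without_x) + card (cube_edges y link_x)"
    unfolding eq using card_Un_le card_image_le[OF fin'(2)] by (meson add_left_mono le_trans)
  also have "\<dots> = card (cube_edges y without_x \<union> cube_edges y link_x)
      + card (cube_edges y without_x \<inter> cube_edges y link_x)"
    by (rule card_Un_Int[OF fin'(1,2)])
  also have "cube_edges y without_x \<inter> cube_edges y link_x = cube_edges y (without_x \<inter> link_x)"
    by (auto simp: cube_edges_def)
  also have "card (cube_edges y without_x \<union> cube_edges y link_x) \<le>
      card (cube_edges y (without_x \<union> link_x))"
    by (rule card_mono[OF fin'(3)]) (auto simp: cube_edges_def)
  finally show ?thesis by simp
qed

lemma cube_edges_x: "cube_edges x F = without_x \<inter> link_x"
  by (auto simp: cube_edges_def without_x_def link_x_def)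

lemma vc_less_union:
  assumes "vc_less k (insert x A) F"
  shows "vc_less k A (without_x \<union> link_x)"
  unfolding vc_less_def
proof (intro allI impI)
  fix S assume S: "S \<subseteq> A" "shatters (without_x \<union> link_x) S"
  have "shatters F S"
    unfolding shatters_def
  proof (intro allI impI)
    fix T assume "T \<subseteq> S"
    then obtain Q where Q: "Q \<in> without_x \<union> link_x" "Q \<inter> S = T"
      using S(2) unfolding shatters_def by blast
    moreover have "insert x Q \<inter> S = Q \<inter> S" using S(1) x by auto
    ultimately show "\<exists>Q\<in>F. Q \<inter> S = T"
      unfolding without_x_def link_x_def by blast
  qed
  then show "card S < k" using assms S(1) unfolding vc_less_def by blast
qed

text \<open>A set in the intersection belongs to \<open>F\<close> both with and without
  \<open>x\<close>. Hence whatever the intersection shatters can be enlarged by \<open>x\<close> and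
  is still shattered by \<open>F\<close>, so the dimension drops by one.\<close>

lemma vc_less_inter:
  assumes "vc_less (Suc k) (insert x A) F"
  shows "vc_less k A (without_x \<inter> link_x)"
  unfolding vc_less_def
proof (intro allI impI)
  fix S assume S: "S \<subseteq> A" "shatters (without_x \<inter> link_x) S"
  have "shatters F (insert x S)"
    unfolding shatters_def
  proof (intro allI impI)
    fix T assume T: "T \<subseteq> insert x S"
    then have "T - {x} \<subseteq> S" by auto
    then obtain Q where Q: "Q \<in> without_x" "Q \<in> link_x" "Q \<inter> S = T - {x}"
      using S(2) unfolding shatters_def by blast
    show "\<exists>Q\<in>F. Q \<inter> insert x S = T"
    proof (cases "x \<in> T")
      case True
      then show ?thesis
        using Q by (intro bexI[of _ "insert x Q"]) (auto simp: link_x_def)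
    next
      case False
      then show ?thesis
        using Q by (intro bexI[of _ Q]) (auto simp: without_x_def)
    qed
  qed
  then have "card (insert x S) < Suc k" using assms S(1) unfolding vc_less_def by blast
  moreover have "x \<notin> S" "finite S" using S(1) x finite_subset[OF S(1) fin] by auto
  ultimately show "card S < k" by simp
qed

end

section \<open>Size and edge density of families of bounded VC dimension\<close>

text \<open>Removing one element splits the size into a union with the same dimension bound and an
  intersection with a bound lower by one, as in Pascal's rule. The coarse bound survives because
  \<open>(n + 1) ^ d + (n + 1) ^ (d - 1) \<le> (n + 2) ^ d\<close> for
  \<open>d \<ge> 1\<close>.\<close>

lemma sauer_shelah:
  assumes "finite A" "F \<subseteq> Pow A" "vc_less (Suc d) A F"
  shows "card F \<le> (card A + 1) ^ d"
  using assms
proof (induction A arbitrary: F d rule: finite_induct)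
  case empty
  then have "F = {} \<or> F = {{}}" by auto
  then show ?case by auto
next
  case (insert x A)
  let ?U = "without_x F x \<union> link_x F x" and ?I = "without_x F x \<inter> link_x F x"
  note ctxt = insert.hyps(1,2) insert.prems(1)
  have sub: "?U \<subseteq> Pow A" "?I \<subseteq> Pow A" using parts_subset[OF ctxt] by auto
  have U: "card ?U \<le> (card A + 1) ^ d"
    by (rule insert.IH[OF sub(1) vc_less_union[OF ctxt insert.prems(2)]])
  have I: "vc_less d A ?I" by (rule vc_less_inter[OF ctxt insert.prems(2)])
  show ?case
  proof (cases d)
    case 0
    then show ?thesis using U I card_F[OF ctxt] by (simp add: vc_less_0_iff)
  next
    case (Suc e)
    then have "card ?I \<le> (card A + 1) ^ e" using I insert.IH[OF sub(2)] by blast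
    then have "card F \<le> (card A + 2) * (card A + 1) ^ e"
      using U card_F[OF ctxt] Suc by simp
    also have "\<dots> \<le> (card A + 2) * (card A + 2) ^ e"
      by (intro mult_left_mono power_mono) auto
    finally show ?thesis using insert.hyps Suc by simp
  qed
qed

text \<open>The one-inclusion graph has at most \<open>k - 1\<close> edges per vertex; the summand
  \<open>card F\<close> on the left avoids truncated subtraction. In the induction each member of
  the intersection contributes one new edge of direction \<open>x\<close>, and the lower dimension
  of the intersection leaves room for exactly that edge.\<close>

lemma sum_card_cube_edges_le:
  assumes "finite A" "F \<subseteq> Pow A" "vc_less k A F"
  shows "(\<Sum>x\<in>A. card (cube_edges x F)) + card F \<le> k * card F"
  using assms
proof (induction A arbitrary: F k rule: finite_induct)
  case empty
  then show ?case by (cases k) (auto simp: vc_less_0_iff)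
next
  case (insert x A)
  let ?U = "without_x F x \<union> link_x F x" and ?I = "without_x F x \<inter> link_x F x"
  note ctxt = insert.hyps(1,2) insert.prems(1)
  have sub: "?U \<subseteq> Pow A" "?I \<subseteq> Pow A" using parts_subset[OF ctxt] by auto
  show ?case
  proof (cases k)
    case 0
    then show ?thesis using insert.prems by (simp add: vc_less_0_iff cube_edges_def)
  next
    case (Suc j)
    have U: "(\<Sum>y\<in>A. card (cube_edges y ?U)) + card ?U \<le> k * card ?U"
      by (rule insert.IH[OF sub(1) vc_less_union[OF ctxt insert.prems(2)]])
    have I: "(\<Sum>y\<in>A. card (cube_edges y ?I)) + card ?I \<le> j * card ?I"
      by (rule insert.IH[OF sub(2) vc_less_inter[OF ctxt insert.prems(2)[unfolded Suc]]])
    have "(\<Sum>y\<in>A. card (cube_edges y F)) \<le>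
        (\<Sum>y\<in>A. card (cube_edges y ?U)) + (\<Sum>y\<in>A. card (cube_edges y ?I))"
      unfolding sum.distrib[symmetric] by (intro sum_mono card_cube_edges_F[OF ctxt])
    then show ?thesis
      using U I insert.hyps
      by (simp add: cube_edges_x[OF ctxt] card_F[OF ctxt] Suc algebra_simps)
  qed
qed

text \<open>Layer cake: the minimum is a sum over the level sets \<open>{Q. t < w Q}\<close>, each a subfamily.\<close>

lemma sum_min_cube_edges_le:
  fixes w :: "'a set \<Rightarrow> nat"
  assumes "finite A" "vc_less (Suc d) A {Q \<in> Pow A. 0 < w Q}"
  shows "(\<Sum>x\<in>A. \<Sum>Q\<in>Pow (A - {x}). min (w Q) (w (insert x Q))) \<le> d * (\<Sum>Q\<in>Pow A. w Q)"
proof -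
  define M where "M = (\<Sum>Q\<in>Pow A. w Q)"
  define F where "F t = {Q \<in> Pow A. t < w Q}" for t
  have finP: "finite (Pow A)" using assms by simp
  have le_M: "w Q \<le> M" if "Q \<in> Pow A" for Q
    unfolding M_def by (rule member_le_sum[OF that]) (use finP in auto)
  have layer: "n = (\<Sum>t<M. if t < n then 1 else 0)" if "n \<le> M" for n
  proof -
    have "{..<M} \<inter> {t. t < n} = {..<n}" using that by auto
    then show ?thesis by (simp add: sum.If_cases)
  qed
  have edge: "(\<Sum>Q\<in>Pow (A - {x}). min (w Q) (w (insert x Q))) = (\<Sum>t<M. card (cube_edges x (F t)))"
    if "x \<in> A" for x
  proof -
    have "(\<Sum>Q\<in>Pow (A - {x}). min (w Q) (w (insert x Q)))
        = (\<Sum>Q\<in>Pow (A - {x}). \<Sum>t<M. if t < min (w Q) (w (insert x Q)) then 1 else 0)"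
    proof (rule sum.cong)
      fix Q assume "Q \<in> Pow (A - {x})"
      then have "w Q \<le> M" by (intro le_M) auto
      then show "min (w Q) (w (insert x Q)) = (\<Sum>t<M. if t < min (w Q) (w (insert x Q)) then 1 else 0)"
        by (intro layer) simp
    qed simp
    also have "\<dots> = (\<Sum>t<M. \<Sum>Q\<in>Pow (A - {x}). if t < min (w Q) (w (insert x Q)) then 1 else 0)"
      by (rule sum.swap)
    also have "\<dots> = (\<Sum>t<M. card (cube_edges x (F t)))"
    proof (rule sum.cong)
      fix t
      have "Pow (A - {x}) \<inter> {Q. t < min (w Q) (w (insert x Q))} = cube_edges x (F t)"
        using that by (auto simp: cube_edges_def F_def)
      then show "(\<Sum>Q\<in>Pow (A - {x}). if t < min (w Q) (w (insert x Q)) then 1 else 0)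
          = card (cube_edges x (F t))"
        using assms(1) by (simp add: sum.If_cases)
    qed simp
    finally show ?thesis .
  qed
  have "(\<Sum>x\<in>A. \<Sum>Q\<in>Pow (A - {x}). min (w Q) (w (insert x Q)))
      = (\<Sum>x\<in>A. \<Sum>t<M. card (cube_edges x (F t)))"
    by (rule sum.cong) (simp_all add: edge)
  also have "\<dots> = (\<Sum>t<M. \<Sum>x\<in>A. card (cube_edges x (F t)))"
    by (rule sum.swap)
  also have "\<dots> \<le> (\<Sum>t<M. d * card (F t))"
  proof (rule sum_mono)
    fix t
    have "vc_less (Suc d) A (F t)"
      by (rule vc_less_mono[OF assms(2)]) (auto simp: F_def)
    then have "(\<Sum>x\<in>A. card (cube_edges x (F t))) + card (F t) \<le> Suc d * card (F t)"
      by (intro sum_card_cube_edges_le assms) (auto simp: F_def)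
    then show "(\<Sum>x\<in>A. card (cube_edges x (F t))) \<le> d * card (F t)" by simp
  qed
  also have "\<dots> = d * (\<Sum>t<M. \<Sum>Q\<in>Pow A. if t < w Q then 1 else 0)"
  proof -
    have "card (F t) = (\<Sum>Q\<in>Pow A. if t < w Q then 1 else 0)" for t
    proof -
      have "F t = Pow A \<inter> {Q. t < w Q}" by (auto simp: F_def)
      then show ?thesis using finP by (simp add: sum.If_cases)
    qed
    then show ?thesis by (simp add: sum_distrib_left)
  qed
  also have "(\<Sum>t<M. \<Sum>Q\<in>Pow A. if t < w Q then 1 else 0) = (\<Sum>Q\<in>Pow A. \<Sum>t<M. if t < w Q then 1 else 0)"
    by (rule sum.swap)
  also have "\<dots> = M"
    unfolding M_def by (rule sum.cong[OF refl], rule layer[symmetric, unfolded M_def], rule le_M[unfolded M_def])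
  finally show ?thesis by (simp add: M_def)
qed

text \<open>Sauer-Shelah serves as a counting estimate: a set shattered by this family lies inside
  one of its members, so it has at most \<open>m\<close> elements.\<close>

lemma card_bounded_subsets_le:
  assumes "finite A"
  shows "card {S. S \<subseteq> A \<and> card S \<le> m} \<le> (card A + 1) ^ m"
proof (rule sauer_shelah[OF assms])
  show "vc_less (Suc m) A {S. S \<subseteq> A \<and> card S \<le> m}"
    unfolding vc_less_def
  proof (intro allI impI)
    fix S assume S: "S \<subseteq> A" "shatters {S. S \<subseteq> A \<and> card S \<le> m} S"
    then obtain Q where Q: "Q \<subseteq> A" "card Q \<le> m" "Q \<inter> S = S"
      unfolding shatters_def by blast
    then have "card S \<le> card Q"
      using finite_subset[OF Q(1) assms] by (intro card_mono) auto
    then show "card S < Suc m" using Q(2) by simp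
  qed
qed auto

section \<open>Packing in graphs without large shattered sets\<close>

text \<open>The witnessing vertices are taken outside \<open>S\<close> because the two colour
  classes of a forbidden copy must be disjoint.\<close>

definition shatter_free :: "nat \<Rightarrow> 'a set \<Rightarrow> 'a rel \<Rightarrow> bool" where
  "shatter_free k V E \<longleftrightarrow> (\<forall>S\<subseteq>V. card S = k \<longrightarrow> \<not> shatters ((\<lambda>v. E `` {v}) ` (V - S)) S)"

text \<open>Excluding \<open>u\<close> and \<open>v\<close> ensures that both remain rows outside
  the sample after a separator is added to it.\<close>

definition separators :: "'a set \<Rightarrow> 'a rel \<Rightarrow> 'a \<Rightarrow> 'a \<Rightarrow> 'a set" where
  "separators V E u v = {a \<in> V - {u, v}. (u, a) \<in> E \<longleftrightarrow> (v, a) \<notin> E}"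

definition trace_class :: "'a set \<Rightarrow> 'a rel \<Rightarrow> 'a set \<Rightarrow> 'a set \<Rightarrow> 'a set" where
  "trace_class V E A Q = {v \<in> V - A. E `` {v} \<inter> A = Q}"

text \<open>\<open>shatter_free\<close> speaks of sets of size exactly \<open>d + 1\<close>, so a
  larger shattered set is first cut down to that size. Rows outside \<open>A\<close> are in
  particular outside the smaller set.\<close>

lemma vc_less_traces:
  assumes "finite V" "A \<subseteq> V" "shatter_free (Suc d) V E"
  shows "vc_less (Suc d) A ((\<lambda>v. E `` {v} \<inter> A) ` (V - A))"
  unfolding vc_less_def
proof (intro allI impI, rule ccontr)
  fix S assume S: "S \<subseteq> A" "shatters ((\<lambda>v. E `` {v} \<inter> A) ` (V - A)) S" "\<not> card S < Suc d"
  then obtain S' where S': "S' \<subseteq> S" "card S' = Suc d"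
    by (meson not_less obtain_subset_with_card_n)
  have "shatters ((\<lambda>v. E `` {v}) ` (V - S')) S'"
    unfolding shatters_def
  proof (intro allI impI)
    fix T assume T: "T \<subseteq> S'"
    obtain v where v: "v \<in> V - A" "E `` {v} \<inter> A \<inter> S' = T"
      using shatters_subset[OF S(2) S'(1), unfolded shatters_def, rule_format, OF T] by auto
    moreover have "A \<inter> S' = S'" using S(1) S'(1) by auto
    ultimately show "\<exists>Q\<in>(\<lambda>v. E `` {v}) ` (V - S'). Q \<inter> S' = T"
      by (intro bexI[of _ "E `` {v}"]) (auto simp: Int_assoc)
  qed
  moreover have "S' \<subseteq> V" using S' S assms by auto
  ultimately show False using assms(3) S'(2) unfolding shatter_free_def by simp
qed

section \<open>Counting tools for the packing bound\<close>

lemma sum_card_trace_class: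
  assumes "finite V" "A \<subseteq> V"
  shows "(\<Sum>Q\<in>Pow A. card (trace_class V E A Q)) = card (V - A)"
proof -
  have finA: "finite A" using finite_subset[OF assms(2,1)] .
  have "card (V - A) = card (\<Union>Q\<in>Pow A. trace_class V E A Q)"
    by (intro arg_cong[where f = card] set_eqI) (simp add: trace_class_def)
  also have "\<dots> = (\<Sum>Q\<in>Pow A. card (trace_class V E A Q))"
    using finA assms(1) by (intro card_UN_disjoint) (simp_all add: trace_class_def, blast)
  finally show ?thesis by simp
qed

text \<open>Ordered pairs of distinct members of \<open>C\<close> are counted together with the
  points separating them. Each pair has at least \<open>k\<close> such points, while a point
  separates at most twice the product of its two sides, and the larger side is at most
  \<open>card C\<close>. Cancelling \<open>card C\<close> leaves \<open>card C - 1\<close>, whence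
  the additive \<open>k\<close>. The guard \<open>P\<close> will say that the row is not the point
  itself.\<close>

lemma sum_min_separated_ge:
  fixes R :: "'a \<Rightarrow> 'b \<Rightarrow> bool"
  assumes fin: "finite W" "finite C" and ne: "C \<noteq> {}"
    and sep: "\<And>u v. u \<in> C \<Longrightarrow> v \<in> C \<Longrightarrow> u \<noteq> v \<Longrightarrow>
      k \<le> card {a \<in> W. P u a \<and> P v a \<and> (R u a \<longleftrightarrow> \<not> R v a)}"
  shows "k * card C \<le> k + 2 * (\<Sum>a\<in>W. min (card {v \<in> C. P v a \<and> \<not> R v a}) (card {v \<in> C. P v a \<and> R v a}))"
proof -
  define X Y where "X a = {v \<in> C. P v a \<and> \<not> R v a}" and "Y a = {v \<in> C. P v a \<and> R v a}" for a
  define Z where "Z u v a \<longleftrightarrow> P u a \<and> P v a \<and> (R u a \<longleftrightarrow> \<not> R v a)" for u v a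
  define b where "b = card C"
  define M where "M = (\<Sum>a\<in>W. min (card (X a)) (card (Y a)))"
  have b: "b > 0" using fin ne by (simp add: b_def card_gt_0_iff)
  have finXY: "finite (X a)" "finite (Y a)" for a using fin by (auto simp: X_def Y_def)
  have le_b: "card (X a) \<le> b" "card (Y a) \<le> b" for a
    unfolding b_def using fin by (auto simp: X_def Y_def intro: card_mono)
  have prod_le: "card (X a) * card (Y a) \<le> b * min (card (X a)) (card (Y a))" for a
    using le_b[of a] by (auto simp: min_def mult.commute)
  have pairs: "card {p \<in> C \<times> C. Z (fst p) (snd p) a} \<le> 2 * (card (X a) * card (Y a))" for a
  proof -
    have "{p \<in> C \<times> C. Z (fst p) (snd p) a} \<subseteq> X a \<times> Y a \<union> Y a \<times> X a"
      by (auto simp: X_def Y_def Z_def)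
    then have "card {p \<in> C \<times> C. Z (fst p) (snd p) a} \<le> card (X a \<times> Y a \<union> Y a \<times> X a)"
      by (intro card_mono) (auto simp: finXY)
    also have "\<dots> \<le> card (X a \<times> Y a) + card (Y a \<times> X a)" by (rule card_Un_le)
    finally show ?thesis by (simp add: card_cartesian_product mult.commute)
  qed
  define D where "D = {p \<in> C \<times> C. fst p \<noteq> snd p}"
  have finD: "finite D" using fin by (auto simp: D_def)
  have cardD: "card D = b * (b - 1)"
  proof -
    have "D = C \<times> C - (\<lambda>v. (v, v)) ` C" by (auto simp: D_def)
    moreover have "card ((\<lambda>v. (v, v)) ` C) = b"
      unfolding b_def by (intro card_image inj_onI) auto
    moreover have "card (C \<times> C - (\<lambda>v. (v, v)) ` C) = card (C \<times> C) - card ((\<lambda>v. (v, v)) ` C)"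
      using fin by (intro card_Diff_subset) auto
    ultimately have "card D = b * b - b"
      by (simp only: card_cartesian_product b_def)
    then show ?thesis by (simp add: diff_mult_distrib2)
  qed
  have "k * (b * (b - 1)) = (\<Sum>p\<in>D. k)" by (simp add: cardD)
  also have "\<dots> \<le> (\<Sum>p\<in>D. card {a \<in> W. Z (fst p) (snd p) a})"
    unfolding Z_def by (intro sum_mono sep) (auto simp: D_def)
  also have "\<dots> \<le> (\<Sum>p\<in>C \<times> C. card {a \<in> W. Z (fst p) (snd p) a})"
    using fin by (intro sum_mono2) (auto simp: D_def)
  also have "\<dots> = (\<Sum>p\<in>C \<times> C. \<Sum>a\<in>W. if Z (fst p) (snd p) a then 1 else 0)"
    using fin by (simp add: sum.If_cases Int_def)
  also have "\<dots> = (\<Sum>a\<in>W. \<Sum>p\<in>C \<times> C. if Z (fst p) (snd p) a then 1 else 0)"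
    by (rule sum.swap)
  also have "\<dots> = (\<Sum>a\<in>W. card {p \<in> C \<times> C. Z (fst p) (snd p) a})"
    using fin by (simp add: sum.If_cases Int_def)
  also have "\<dots> \<le> (\<Sum>a\<in>W. 2 * (b * min (card (X a)) (card (Y a))))"
    by (intro sum_mono order_trans[OF pairs] mult_left_mono prod_le) simp
  also have "\<dots> = b * (2 * M)"
    by (simp add: M_def sum_distrib_left mult.left_commute)
  finally have "b * (k * (b - 1)) \<le> b * (2 * M)" by (simp add: mult.left_commute)
  then have "k * (b - 1) \<le> 2 * M" using b by simp
  then have "k * b \<le> k + 2 * M" using b by (cases b) auto
  then show ?thesis by (simp add: b_def M_def X_def Y_def)
qed

text \<open>A set of size \<open>t + 1\<close> with a marked element is the same as a set of size
  \<open>t\<close> with a marked outside point. This lets one double sum be bounded from both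
  sides.\<close>

lemma sum_remove_element:
  fixes g :: "'a set \<Rightarrow> 'a \<Rightarrow> nat"
  assumes "finite V"
  shows "(\<Sum>A | A \<subseteq> V \<and> card A = Suc t. \<Sum>a\<in>A. g (A - {a}) a) =
    (\<Sum>A | A \<subseteq> V \<and> card A = t. \<Sum>a\<in>V - A. g A a)"
proof -
  have fin: "finite A" if "A \<subseteq> V" for A using finite_subset[OF that assms] .
  have finC: "finite {A. A \<subseteq> V \<and> card A = m}" for m using assms by simp
  have "(\<Sum>A | A \<subseteq> V \<and> card A = Suc t. \<Sum>a\<in>A. g (A - {a}) a) =
      (\<Sum>(A, a)\<in>Sigma {A. A \<subseteq> V \<and> card A = Suc t} (\<lambda>A. A). g (A - {a}) a)"
    using finC fin by (intro sum.Sigma) auto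
  also have "\<dots> = (\<Sum>(A, a)\<in>Sigma {A. A \<subseteq> V \<and> card A = t} (\<lambda>A. V - A). g A a)"
    by (rule sum.reindex_bij_witness
        [where i = "\<lambda>(A, a). (insert a A, a)" and j = "\<lambda>(A, a). (A - {a}, a)"])
      (auto simp: fin insert_absorb card_Suc_Diff1 card_Diff_singleton)
  also have "\<dots> = (\<Sum>A | A \<subseteq> V \<and> card A = t. \<Sum>a\<in>V - A. g A a)"
    using finC assms by (intro sum.Sigma[symmetric]) auto
  finally show ?thesis .
qed

text \<open>Haussler's packing bound by Chazelle's double counting over all vertex sets of size
  \<open>t\<close> and \<open>t + 1\<close>. Only rows outside the sampled set \<open>A\<close> are used, so that shattering within
  \<open>A\<close> yields a copy of the universal graph with disjoint colour classes.\<close>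

lemma separated_packing:
  assumes fin: "finite V" and free: "shatter_free (Suc d) V E"
    and sep: "\<And>u v. u \<in> V \<Longrightarrow> v \<in> V \<Longrightarrow> u \<noteq> v \<Longrightarrow> k \<le> card (separators V E u v)"
    and t: "t \<le> card V"
  shows "Suc t * k * (card V - t) \<le> Suc t * k * Suc t ^ d + 2 * d * card V * (card V - t)"
proof -
  define n where "n = card V"
  \<comment> \<open>Weighting each trace by the number of rows having it, this is the total weight
    of the edges of direction \<open>a\<close> for the sample \<open>insert a A\<close>.\<close>
  define g where "g A a = (\<Sum>Q\<in>Pow A. min (card (trace_class V E (insert a A) Q))
      (card (trace_class V E (insert a A) (insert a Q))))" for A a
  have finA: "finite A" if "A \<subseteq> V" for A using finite_subset[OF that fin] .
  \<comment> \<open>With the enlarged sample fixed, the weighted edge-density bound controls all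
    directions at once.\<close>
  have upper: "(\<Sum>a\<in>A. g (A - {a}) a) \<le> d * n" if A: "A \<subseteq> V" for A
  proof -
    have eq: "{Q \<in> Pow A. 0 < card (trace_class V E A Q)} = (\<lambda>v. E `` {v} \<inter> A) ` (V - A)"
      using fin by (auto simp: card_gt_0_iff trace_class_def)
    have "(\<Sum>a\<in>A. g (A - {a}) a) = (\<Sum>a\<in>A. \<Sum>Q\<in>Pow (A - {a}).
        min (card (trace_class V E A Q)) (card (trace_class V E A (insert a Q))))"
      by (intro sum.cong) (simp_all add: g_def insert_absorb)
    also have "\<dots> \<le> d * (\<Sum>Q\<in>Pow A. card (trace_class V E A Q))"
      by (rule sum_min_cube_edges_le[OF finA[OF A]])
        (use vc_less_traces[OF fin A free] in \<open>simp only: eq\<close>)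
    also have "\<dots> = d * card (V - A)" using sum_card_trace_class[OF fin A] by simp
    also have "\<dots> \<le> d * n" unfolding n_def using fin by (intro mult_left_mono card_mono) auto
    finally show ?thesis .
  qed
  \<comment> \<open>With the smaller sample fixed, rows in one trace class agree on
    \<open>A\<close>, so all their separators lie outside \<open>A\<close>. Each nonempty class
    costs an additive \<open>k\<close>, and Sauer-Shelah bounds the number of such classes.\<close>
  have lower: "k * (n - t) \<le> k * Suc t ^ d + 2 * (\<Sum>a\<in>V - A. g A a)"
    if A: "A \<subseteq> V" "card A = t" for A
  proof -
    define \<T> where "\<T> = (\<lambda>v. E `` {v} \<inter> A) ` (V - A)"
    define m where "m Q a = min (card (trace_class V E (insert a A) Q))
      (card (trace_class V E (insert a A) (insert a Q)))" for Q a
    have sub: "\<T> \<subseteq> Pow A" and fT: "finite \<T>" using fin by (auto simp: \<T>_def)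
    have empty: "trace_class V E A Q = {}" if "Q \<notin> \<T>" for Q
      using that by (auto simp: \<T>_def trace_class_def)
    have cardT: "card \<T> \<le> Suc t ^ d"
      using sauer_shelah[OF finA[OF A(1)] sub] vc_less_traces[OF fin A(1) free] A(2)
      by (simp add: \<T>_def)
    have "card (V - A) = (\<Sum>Q\<in>Pow A. card (trace_class V E A Q))"
      by (rule sum_card_trace_class[OF fin A(1), symmetric])
    also have "\<dots> = (\<Sum>Q\<in>\<T>. card (trace_class V E A Q))"
      using finA[OF A(1)] sub empty by (intro sum.mono_neutral_right) auto
    finally have "k * (n - t) = (\<Sum>Q\<in>\<T>. k * card (trace_class V E A Q))"
      using A fin finA by (simp add: card_Diff_subset n_def sum_distrib_left)
    also have "\<dots> \<le> (\<Sum>Q\<in>\<T>. k + 2 * (\<Sum>a\<in>V - A. m Q a))"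
    proof (rule sum_mono)
      fix Q assume Q: "Q \<in> \<T>"
      let ?C = "trace_class V E A Q"
      \<comment> \<open>The condition \<open>v \<noteq> a\<close> reflects that the vertex
        \<open>a\<close> ceases to be a row once it joins the sample.\<close>
      have "k * card ?C \<le> k + 2 * (\<Sum>a\<in>V - A. min (card {v \<in> ?C. v \<noteq> a \<and> (v, a) \<notin> E})
          (card {v \<in> ?C. v \<noteq> a \<and> (v, a) \<in> E}))"
      proof (rule sum_min_separated_ge)
        show "finite (V - A)" "finite ?C" using fin by (auto simp: trace_class_def)
        show "?C \<noteq> {}" using Q by (auto simp: \<T>_def trace_class_def)
        fix u v assume uv: "u \<in> ?C" "v \<in> ?C" "u \<noteq> v"
        then have "(u, a) \<in> E \<longleftrightarrow> (v, a) \<in> E" if "a \<in> A" for a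
          using that by (auto simp: trace_class_def)
        then have "separators V E u v \<subseteq> {a \<in> V - A. u \<noteq> a \<and> v \<noteq> a \<and> (((u, a) \<in> E) = ((v, a) \<notin> E))}"
          by (auto simp: separators_def)
        then have "card (separators V E u v) \<le>
            card {a \<in> V - A. u \<noteq> a \<and> v \<noteq> a \<and> (((u, a) \<in> E) = ((v, a) \<notin> E))}"
          using fin by (intro card_mono) auto
        moreover have "k \<le> card (separators V E u v)"
          using uv by (intro sep) (auto simp: trace_class_def)
        ultimately show "k \<le> card {a \<in> V - A. u \<noteq> a \<and> v \<noteq> a \<and> (((u, a) \<in> E) = ((v, a) \<notin> E))}"
          by linarith
      qed
      also have "(\<Sum>a\<in>V - A. min (card {v \<in> ?C. v \<noteq> a \<and> (v, a) \<notin> E})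
          (card {v \<in> ?C. v \<noteq> a \<and> (v, a) \<in> E})) = (\<Sum>a\<in>V - A. m Q a)"
      proof (rule sum.cong)
        fix a assume a: "a \<in> V - A"
        have aQ: "a \<notin> Q" "a \<notin> A" using Q sub a by auto
        have trace: "E `` {v} \<inter> insert a A = (if (v, a) \<in> E then insert a (E `` {v} \<inter> A) else E `` {v} \<inter> A)" for v
          by auto
        have "{v \<in> ?C. v \<noteq> a \<and> (v, a) \<notin> E} = trace_class V E (insert a A) Q"
          unfolding trace_class_def trace using aQ by auto
        moreover have "{v \<in> ?C. v \<noteq> a \<and> (v, a) \<in> E} = trace_class V E (insert a A) (insert a Q)"
          unfolding trace_class_def trace using aQ by (auto simp: insert_ident)
        ultimately show "min (card {v \<in> ?C. v \<noteq> a \<and> (v, a) \<notin> E}) (card {v \<in> ?C. v \<noteq> a \<and> (v, a) \<in> E}) = m Q a"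
          by (simp add: m_def)
      qed simp
      finally show "k * card ?C \<le> k + 2 * (\<Sum>a\<in>V - A. m Q a)" .
    qed
    also have "\<dots> = k * card \<T> + 2 * (\<Sum>a\<in>V - A. \<Sum>Q\<in>\<T>. m Q a)"
      by (subst sum.swap) (simp add: sum.distrib sum_distrib_left)
    also have "\<dots> \<le> k * Suc t ^ d + 2 * (\<Sum>a\<in>V - A. g A a)"
      unfolding g_def m_def[symmetric] using cardT finA[OF A(1)] sub
      by (intro add_mono mult_left_mono sum_mono sum_mono2) auto
    finally show ?thesis .
  qed
  \<comment> \<open>This identity converts the average over sets of size \<open>t + 1\<close> into
    one over sets of size \<open>t\<close>.\<close>
  have binom: "Suc t * (n choose Suc t) = (n - t) * (n choose t)"
    by (simp only: binomial_absorption binomial_absorb_comp)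
  have "(n choose t) * (k * (n - t)) = (\<Sum>A | A \<subseteq> V \<and> card A = t. k * (n - t))"
    using fin by (simp add: n_subsets n_def)
  also have "\<dots> \<le> (\<Sum>A | A \<subseteq> V \<and> card A = t. k * Suc t ^ d + 2 * (\<Sum>a\<in>V - A. g A a))"
    using lower by (intro sum_mono) auto
  also have "\<dots> = (n choose t) * (k * Suc t ^ d) + 2 * (\<Sum>A | A \<subseteq> V \<and> card A = t. \<Sum>a\<in>V - A. g A a)"
    using fin by (simp add: sum.distrib sum_distrib_left n_subsets n_def)
  also have "(\<Sum>A | A \<subseteq> V \<and> card A = t. \<Sum>a\<in>V - A. g A a) =
      (\<Sum>A | A \<subseteq> V \<and> card A = Suc t. \<Sum>a\<in>A. g (A - {a}) a)"
    by (rule sum_remove_element[OF fin, symmetric])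
  also have "\<dots> \<le> (\<Sum>A | A \<subseteq> V \<and> card A = Suc t. d * n)"
    using upper by (intro sum_mono) auto
  also have "\<dots> = (n choose Suc t) * (d * n)"
    using fin by (simp add: n_subsets n_def)
  finally have "Suc t * ((n choose t) * (k * (n - t))) \<le>
      Suc t * ((n choose t) * (k * Suc t ^ d) + 2 * ((n choose Suc t) * (d * n)))"
    by (intro mult_left_mono) auto
  also have "\<dots> = (n choose t) * (Suc t * (k * Suc t ^ d)) + 2 * (d * n) * (Suc t * (n choose Suc t))"
    by (simp only: distrib_left mult_ac)
  also have "\<dots> = (n choose t) * (Suc t * k * Suc t ^ d + 2 * d * n * (n - t))"
    unfolding binom by (simp only: distrib_left mult_ac)
  finally have "(n choose t) * (Suc t * k * (n - t)) \<le>
      (n choose t) * (Suc t * k * Suc t ^ d + 2 * d * n * (n - t))"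
    by (simp only: mult_ac)
  moreover have "(n choose t) > 0" using t by (simp add: n_def)
  ultimately show ?thesis by (simp only: n_def mult_le_cancel1)
qed

section \<open>Counting by deletion of near twins\<close>

text \<open>With sample size \<open>t = s - 1\<close> the Sauer-Shelah term \<open>s ^ d\<close> is
  at most half of \<open>n - t\<close>. It is absorbed on the left, and the factor
  \<open>n - t\<close> cancels.\<close>

lemma separated_packing_scaled:
  assumes "finite V" "shatter_free (Suc d) V E"
    and "\<And>u v. u \<in> V \<Longrightarrow> v \<in> V \<Longrightarrow> u \<noteq> v \<Longrightarrow> k \<le> card (separators V E u v)"
    and d: "d \<ge> 1" and s: "s \<ge> 1" "4 * s ^ d \<le> card V"
  shows "k * s \<le> 4 * d * card V"
proof -
  define n where "n = card V"
  obtain t where t: "s = Suc t" using s by (cases s) auto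
  have "s ^ 1 \<le> s ^ d" using s d by (intro power_increasing) auto
  then have ts: "t < s ^ d" using t by simp
  then have half: "2 * s ^ d \<le> n - t" and pos: "n - t > 0" "t \<le> n"
    using s(2) unfolding n_def by linarith+
  have "s * k * (n - t) \<le> s * k * s ^ d + 2 * d * n * (n - t)"
    using separated_packing[OF assms(1-3), of t] pos unfolding n_def t by simp
  moreover have "s * k * (2 * s ^ d) \<le> s * k * (n - t)"
    using half by (rule mult_left_mono) simp
  ultimately have "s * k * (n - t) \<le> 4 * d * n * (n - t)" by linarith
  then show ?thesis using pos by (simp add: n_def mult.commute)
qed

text \<open>A pair with the fewest separators makes the whole vertex set \<open>k\<close>-separated
  for that minimum \<open>k\<close>. The packing bound with \<open>s\<close> of order
  \<open>n powr (1 / d)\<close> then limits \<open>k\<close>.\<close>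

lemma exists_near_twins:
  assumes fin: "finite V" and card: "card V \<ge> 2" and free: "shatter_free (Suc d) V E" and d: "d \<ge> 1"
  shows "\<exists>u\<in>V. \<exists>v\<in>V. u \<noteq> v \<and>
    real (card (separators V E u v)) \<le> 32 * real d * real (card V) powr (1 - 1 / real d)"
proof -
  define n where "n = card V"
  define P where "P p \<longleftrightarrow> fst p \<in> V \<and> snd p \<in> V \<and> fst p \<noteq> snd p" for p :: "'a \<times> 'a"
  define f where "f p = card (separators V E (fst p) (snd p))" for p
  have "\<exists>p. P p"
  proof -
    obtain S where "S \<subseteq> V" "card S = 2" using obtain_subset_with_card_n[OF card] by metis
    then obtain u v where "u \<noteq> v" "{u, v} \<subseteq> V" by (auto simp: card_2_iff)
    then show ?thesis by (intro exI[of _ "(u, v)"]) (auto simp: P_def)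
  qed
  then obtain p where p: "P p" and least: "\<And>q. P q \<Longrightarrow> f p \<le> f q"
    using ex_has_least_nat[of P _ f] by blast
  define k where "k = f p"
  have sep: "k \<le> card (separators V E u v)" if "u \<in> V" "v \<in> V" "u \<noteq> v" for u v
    using least[of "(u, v)"] that by (simp add: P_def f_def k_def)
  have n: "real n \<ge> 2" using card by (simp add: n_def)
  have d1: "1 / real d \<le> 1" "real d \<ge> 1" using d by auto
  have "real k * real n powr (1 / real d) \<le> 32 * real d * real n"
  proof (cases "n \<ge> 4")
    case True
    \<comment> \<open>This \<open>x\<close> solves \<open>4 * x ^ d = n\<close>. Rounding down costs
      a factor 2 and \<open>4 powr (1 / d)\<close> at most 4, so
      \<open>n powr (1 / d) \<le> 8 * s\<close>; with the factor 4 from the packing bound this gives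
      32.\<close>
    define x where "x = (real n / 4) powr (1 / real d)"
    define s where "s = nat \<lfloor>x\<rfloor>"
    have x1: "x \<ge> 1" using True by (auto simp: x_def intro: ge_one_powr_ge_zero)
    have s1: "s \<ge> 1" using x1 by (simp add: s_def le_nat_iff le_floor_iff)
    have sx: "real s \<le> x" "x \<le> 2 * real s"
      using x1 s1 by (simp_all add: s_def) linarith+
    have "real s ^ d \<le> x ^ d" using sx by (intro power_mono) auto
    also have "x ^ d = real n / 4"
      using d True by (simp add: x_def powr_realpow[symmetric] powr_powr)
    finally have "real (4 * s ^ d) \<le> real (card V)" by (simp add: n_def)
    then have "k * s \<le> 4 * d * n"
      unfolding n_def of_nat_le_iff by (intro separated_packing_scaled[OF fin free sep d s1])
    then have ks: "real k * real s \<le> 4 * real d * real n"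
      by (metis of_nat_le_iff of_nat_mult of_nat_numeral)
    have "(4::real) powr (1 / real d) \<le> 4 powr 1" using d1 by (intro powr_mono) auto
    then have "x * 4 powr (1 / real d) \<le> x * 4" using x1 by (intro mult_left_mono) auto
    moreover have "real n powr (1 / real d) = x * 4 powr (1 / real d)"
      by (simp add: x_def powr_mult[symmetric])
    ultimately have "real n powr (1 / real d) \<le> 8 * real s" using sx by linarith
    then have "real k * real n powr (1 / real d) \<le> real k * (8 * real s)"
      by (intro mult_left_mono) auto
    then show ?thesis using ks by linarith
  next
    case False
    have "real n powr (1 / real d) \<le> real n powr 1" using d1 n by (intro powr_mono) auto
    then have "real n powr (1 / real d) \<le> 4" using False n by simp
    moreover have "k \<le> n"
      unfolding k_def f_def n_def by (intro card_mono fin) (auto simp: separators_def)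
    ultimately have "real k * real n powr (1 / real d) \<le> real n * 4"
      by (intro mult_mono) auto
    also have "real n * 4 \<le> real n * (32 * real d)" using d1 by (intro mult_left_mono) auto
    finally show ?thesis by (simp add: mult_ac)
  qed
  then have "real k \<le> 32 * real d * (real n / real n powr (1 / real d))"
    using n by (simp add: pos_le_divide_eq)
  also have "real n / real n powr (1 / real d) = real n powr (1 - 1 / real d)"
    using n by (simp add: powr_diff)
  finally show ?thesis
    using p unfolding k_def f_def P_def n_def by blast
qed

section \<open>Encoding a graph by successive vertex deletions\<close>

definition shatter_free_graphs :: "nat \<Rightarrow> 'a set \<Rightarrow> 'a rel set" where
  "shatter_free_graphs k V = {E. E \<subseteq> V \<times> V \<and> sym E \<and> irrefl E \<and> shatter_free k V E}"

lemma finite_shatter_free_graphs: "finite V \<Longrightarrow> finite (shatter_free_graphs k V)"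
  by (rule finite_subset[of _ "Pow (V \<times> V)"]) (auto simp: shatter_free_graphs_def)

lemma shatter_free_restrict:
  assumes free: "shatter_free k V E" and W: "W \<subseteq> V"
  shows "shatter_free k W (E \<inter> W \<times> W)"
  unfolding shatter_free_def
proof (intro allI impI notI)
  fix S assume S: "S \<subseteq> W" "card S = k" "shatters ((\<lambda>v. (E \<inter> W \<times> W) `` {v}) ` (W - S)) S"
  have "shatters ((\<lambda>v. E `` {v}) ` (V - S)) S"
    unfolding shatters_def
  proof (intro allI impI)
    fix T assume T: "T \<subseteq> S"
    obtain v where v: "v \<in> W - S" "(E \<inter> W \<times> W) `` {v} \<inter> S = T"
      using S(3)[unfolded shatters_def, rule_format, OF T] by auto
    moreover have "(E \<inter> W \<times> W) `` {v} \<inter> S = E `` {v} \<inter> S" using v(1) S(1) by auto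
    ultimately show "\<exists>Q\<in>(\<lambda>v. E `` {v}) ` (V - S). Q \<inter> S = T"
      using W by (intro bexI[of _ "E `` {v}"]) auto
  qed
  moreover have "S \<subseteq> V" using S(1) W by simp
  ultimately show False using free S(2) unfolding shatter_free_def by simp
qed

text \<open>This is the decoder: \<open>v\<close> is added with the row of \<open>u\<close>
  corrected at the places in \<open>S\<close>. Symmetric difference is an involution, so the set of
  differences serves as the correction.\<close>

definition attach_twin :: "'a \<Rightarrow> 'a \<Rightarrow> 'a rel \<Rightarrow> 'a set \<Rightarrow> 'a rel" where
  "attach_twin u v E S = E \<union> {v} \<times> sym_diff (E `` {u}) S \<union> sym_diff (E `` {u}) S \<times> {v}"

lemma attach_twin_delete:
  fixes v :: 'a
  assumes "E \<subseteq> V \<times> V" "sym E" "irrefl E"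
  defines "E' \<equiv> E \<inter> (V - {v}) \<times> (V - {v})"
  shows "attach_twin u v E' (sym_diff (E' `` {u}) (E `` {v})) = E"
proof -
  have "sym_diff (E' `` {u}) (sym_diff (E' `` {u}) (E `` {v})) = E `` {v}" by auto
  moreover have "E = E' \<union> {v} \<times> E `` {v} \<union> E `` {v} \<times> {v}"
    using assms(1-3) by (auto simp: E'_def dest: symD)
  ultimately show ?thesis by (simp add: attach_twin_def)
qed

text \<open>The extra 1 accounts for \<open>u\<close>, which may be adjacent to \<open>v\<close> but
  is never a separator. The vertex \<open>v\<close> occurs in neither row, being deleted from the
  first and not adjacent to itself.\<close>

lemma card_twin_difference_le:
  assumes "finite V" "E \<subseteq> V \<times> V" "irrefl E" "u \<noteq> v"
  shows "card (sym_diff ((E \<inter> (V - {v}) \<times> (V - {v})) `` {u}) (E `` {v})) \<le> card (separators V E u v) + 1"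
proof -
  have "sym_diff ((E \<inter> (V - {v}) \<times> (V - {v})) `` {u}) (E `` {v}) \<subseteq> insert u (separators V E u v)"
    using assms(2-4) by (auto simp: separators_def irrefl_def)
  then have "card (sym_diff ((E \<inter> (V - {v}) \<times> (V - {v})) `` {u}) (E `` {v})) \<le>
      card (insert u (separators V E u v))"
    using assms(1) by (intro card_mono) (auto simp: separators_def)
  also have "\<dots> \<le> card (separators V E u v) + 1"
    using assms(1) by (simp add: card_insert_if separators_def)
  finally show ?thesis .
qed

text \<open>Undoing one deletion needs the pair \<open>(u, v)\<close>, at most
  \<open>(N + 1) ^ 2\<close> choices, and a correction set of size at most \<open>K + 1\<close>, at
  most \<open>(N + 1) ^ (K + 1)\<close> choices. Each vertex thus costs a factor
  \<open>(N + 1) ^ (K + 3)\<close>. With fewer than two vertices only the empty graph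
  exists.\<close>

lemma card_shatter_free_graphs_le:
  fixes V :: "'a set"
  assumes twins: "\<And>(W :: 'a set) E. finite W \<Longrightarrow> 2 \<le> card W \<Longrightarrow> card W \<le> N \<Longrightarrow> shatter_free k W E \<Longrightarrow>
      \<exists>u\<in>W. \<exists>v\<in>W. u \<noteq> v \<and> card (separators W E u v) \<le> K"
    and "finite V" "card V \<le> N"
  shows "card (shatter_free_graphs k V) \<le> (N + 1) ^ (card V * (K + 3))"
  using assms(2,3)
proof (induction "card V" arbitrary: V rule: less_induct)
  case less
  show ?case
  proof (cases "card V \<ge> 2")
    case False
    have "E = {}" if "E \<in> shatter_free_graphs k V" for E
    proof (rule ccontr)
      assume "E \<noteq> {}"
      then obtain a b where ab: "(a, b) \<in> E" by auto
      then have "a \<noteq> b" "{a, b} \<subseteq> V"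
        using that by (auto simp: shatter_free_graphs_def irrefl_def)
      then have "card {a, b} \<le> card V" using less.prems by (intro card_mono)
      then show False using False \<open>a \<noteq> b\<close> by simp
    qed
    then have "card (shatter_free_graphs k V) \<le> card {{} :: 'a rel}"
      by (intro card_mono) auto
    also have "\<dots> \<le> (N + 1) ^ (card V * (K + 3))" by simp
    finally show ?thesis .
  next
    case True
    define B where "B = (N + 1) ^ ((card V - 1) * (K + 3))"
    define \<S> where "\<S> = {S. S \<subseteq> V \<and> card S \<le> K + 1}"
    define \<D> where "\<D> p = (\<lambda>(E, S). attach_twin (fst p) (snd p) E S) `
        (shatter_free_graphs k (V - {snd p}) \<times> \<S>)" for p
    have finS: "finite \<S>" using less.prems by (simp add: \<S>_def)
    have cardS: "card \<S> \<le> (N + 1) ^ (K + 1)"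
    proof -
      have "card \<S> \<le> (card V + 1) ^ (K + 1)"
        unfolding \<S>_def by (rule card_bounded_subsets_le[OF less.prems(1)])
      also have "\<dots> \<le> (N + 1) ^ (K + 1)" using less.prems by (intro power_mono) auto
      finally show ?thesis .
    qed
    have finD: "finite (\<D> p)" for p
      unfolding \<D>_def using finS less.prems by (intro finite_imageI finite_cartesian_product finite_shatter_free_graphs) auto
    have cardD: "card (\<D> p) \<le> B * (N + 1) ^ (K + 1)" if "p \<in> V \<times> V" for p
    proof -
      have c: "card (V - {snd p}) = card V - 1" using that less.prems by auto
      then have "card (shatter_free_graphs k (V - {snd p})) \<le> B"
        using less.hyps[of "V - {snd p}"] less.prems True by (simp add: B_def)
      moreover have "card (\<D> p) \<le> card (shatter_free_graphs k (V - {snd p}) \<times> \<S>)"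
        unfolding \<D>_def using finS less.prems
        by (intro card_image_le finite_cartesian_product finite_shatter_free_graphs) auto
      ultimately show ?thesis
        using mult_mono[OF _ cardS] by (fastforce simp: card_cartesian_product intro: order_trans)
    qed
    have "shatter_free_graphs k V \<subseteq> (\<Union>p\<in>V \<times> V. \<D> p)"
    proof
      fix E assume E: "E \<in> shatter_free_graphs k V"
      then have E': "E \<subseteq> V \<times> V" "sym E" "irrefl E" "shatter_free k V E"
        by (auto simp: shatter_free_graphs_def)
      obtain u v where uv: "u \<in> V" "v \<in> V" "u \<noteq> v" "card (separators V E u v) \<le> K"
        using twins[OF less.prems(1) True less.prems(2) E'(4)] by auto
      let ?E = "E \<inter> (V - {v}) \<times> (V - {v})"
      let ?S = "sym_diff (?E `` {u}) (E `` {v})"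
      have "?E \<in> shatter_free_graphs k (V - {v})"
        using E' shatter_free_restrict[OF E'(4), of "V - {v}"]
        by (auto simp: shatter_free_graphs_def sym_def irrefl_def)
      moreover have "?S \<in> \<S>"
        using card_twin_difference_le[OF less.prems(1) E'(1,3) uv(3)] uv(4) E'(1)
        by (auto simp: \<S>_def)
      ultimately have "attach_twin u v ?E ?S \<in> \<D> (u, v)"
        unfolding \<D>_def by (intro image_eqI[of _ _ "(?E, ?S)"]) auto
      then show "E \<in> (\<Union>p\<in>V \<times> V. \<D> p)"
        unfolding attach_twin_delete[OF E'(1-3)] using uv by auto
    qed
    then have "card (shatter_free_graphs k V) \<le> card (\<Union>p\<in>V \<times> V. \<D> p)"
      using less.prems finD by (intro card_mono) auto
    also have "\<dots> \<le> (\<Sum>p\<in>V \<times> V. card (\<D> p))"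
      using less.prems by (intro card_UN_le) auto
    also have "\<dots> \<le> (\<Sum>p\<in>V \<times> V. B * (N + 1) ^ (K + 1))"
      by (intro sum_mono cardD)
    also have "\<dots> = card V * card V * (B * (N + 1) ^ (K + 1))"
      by (simp add: card_cartesian_product)
    also have "\<dots> \<le> (N + 1) * (N + 1) * (B * (N + 1) ^ (K + 1))"
      using less.prems by (intro mult_mono) auto
    also have "\<dots> = (N + 1) ^ ((K + 3) + (card V - 1) * (K + 3))"
      unfolding B_def power_add by (simp add: power_add numeral_eq_Suc algebra_simps)
    also have "(K + 3) + (card V - 1) * (K + 3) = card V * (K + 3)"
      using True by (cases "card V") auto
    finally show ?thesis .
  qed
qed

section \<open>Universal graphs\<close>

text \<open>After numbering \<open>S\<close> by \<open>h\<close>, a vertex of \<open>B\<close> is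
  sent to the numbered version of its trace on \<open>S\<close>. Adjacency then becomes membership,
  and bijectivity of the traces makes every subset occur exactly once.\<close>

lemma digraph_iso_universal_graph:
  assumes G: "pair_graph G" and S: "S \<subseteq> pverts G" "card S = k"
    and B: "B \<subseteq> pverts G - S"
    and traces: "bij_betw (\<lambda>v. parcs G `` {v} \<inter> S) B (Pow S)"
  shows "digraph_iso (with_proj (between_graph G S B)) (with_proj (universal_graph k))"
proof -
  interpret pair_graph G by (rule G)
  define E where "E = parcs G"
  have symE: "(b, a) \<in> E" if "(a, b) \<in> E" for a b
    using that pair_sym_arcs by (auto simp: E_def symmetric_def dest: symD)
  have finS: "finite S" using finite_subset[OF S(1) pair_finite_verts] .
  then obtain h where h: "bij_betw h S {..<k}"
    using ex_bij_betw_finite_nat[OF finS] S(2) by (auto simp: atLeast0LessThan)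
  then have injh: "inj_on h S" and imh: "h ` S = {..<k}" by (auto simp: bij_betw_def)
  define tr where "tr v = E `` {v} \<inter> S" for v
  have injt: "inj_on tr B" and imt: "tr ` B = Pow S"
    using traces by (auto simp: bij_betw_def tr_def[abs_def] E_def)
  define \<phi> where "\<phi> v = (if v \<in> S then Inl (h v) else Inr (h ` tr v))" for v
  have disj: "v \<notin> S" if "v \<in> B" for v using that B by auto
  have \<phi>S: "\<phi> v = Inl (h v)" if "v \<in> S" for v using that by (simp add: \<phi>_def)
  have \<phi>B: "\<phi> v = Inr (h ` tr v)" if "v \<in> B" for v using disj[OF that] by (simp add: \<phi>_def)
  have tr_sub: "tr v \<subseteq> S" for v by (auto simp: tr_def)
  have inj\<phi>: "inj_on \<phi> (S \<union> B)"
  proof (rule inj_onI)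
    fix u v assume uv: "u \<in> S \<union> B" "v \<in> S \<union> B" and eq: "\<phi> u = \<phi> v"
    show "u = v"
    proof (cases "u \<in> S")
      case True
      then have "v \<in> S" using eq uv by (auto simp: \<phi>_def split: if_splits)
      then show ?thesis using True eq injh by (simp add: \<phi>_def inj_on_eq_iff)
    next
      case False
      then have "v \<notin> S" "h ` tr u = h ` tr v" using eq by (auto simp: \<phi>_def split: if_splits)
      then have "tr u = tr v" using inj_on_image_eq_iff[OF injh tr_sub tr_sub] by simp
      then show ?thesis using injt uv False \<open>v \<notin> S\<close> by (auto dest: inj_onD)
    qed
  qed
  have im\<phi>: "\<phi> ` (S \<union> B) = pverts (universal_graph k)"
  proof -
    have "\<phi> ` S = Inl ` h ` S" unfolding image_image by (rule image_cong) (simp_all add: \<phi>S)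
    moreover have "\<phi> ` B = Inr ` (`) h ` tr ` B"
      unfolding image_image by (rule image_cong) (simp_all add: \<phi>B)
    ultimately show ?thesis
      by (simp only: image_Un imt imh image_Pow_surj[OF imh]) (simp add: universal_graph_def)
  qed
  have h_mem: "h a \<in> h ` tr v \<longleftrightarrow> (v, a) \<in> E" if "a \<in> S" for a v
    using inj_on_image_mem_iff[OF injh that tr_sub] that by (simp add: tr_def)
  have arcs_eq: "map_prod \<phi> \<phi> ` (E \<inter> (S \<times> B \<union> B \<times> S)) = parcs (universal_graph k)"
  proof (intro equalityI subsetI)
    fix e assume "e \<in> map_prod \<phi> \<phi> ` (E \<inter> (S \<times> B \<union> B \<times> S))"
    then obtain u v where uv: "(u, v) \<in> E" "e = (\<phi> u, \<phi> v)" "u \<in> S \<and> v \<in> B \<or> u \<in> B \<and> v \<in> S"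
      by auto
    have sub: "h ` tr w \<subseteq> {..<k}" for w using image_mono[OF tr_sub, of h w] unfolding imh .
    from uv(3) show "e \<in> parcs (universal_graph k)"
    proof
      assume "u \<in> S \<and> v \<in> B"
      then have "e = (Inl (h u), Inr (h ` tr v))" "h u \<in> h ` tr v"
        using uv(2) symE[OF uv(1)] by (simp_all add: \<phi>S \<phi>B h_mem)
      then show ?thesis using sub[of v] unfolding universal_graph_def by simp
    next
      assume "u \<in> B \<and> v \<in> S"
      then have "e = (Inr (h ` tr u), Inl (h v))" "h v \<in> h ` tr u"
        using uv(1,2) by (simp_all add: \<phi>S \<phi>B h_mem)
      then show ?thesis using sub[of u] unfolding universal_graph_def by simp
    qed
  next
    fix e assume "e \<in> parcs (universal_graph k)"
    then obtain a b where ab: "b \<subseteq> {..<k}" "a \<in> b" "e = (Inl a, Inr b) \<or> e = (Inr b, Inl a)"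
      unfolding universal_graph_def by auto
    obtain x where x: "x \<in> S" "a = h x" using ab(1,2) imh by auto
    have "b \<in> (`) h ` tr ` B" unfolding imt image_Pow_surj[OF imh] using ab(1) by simp
    then obtain v where v: "v \<in> B" "b = h ` tr v" by auto
    have "(v, x) \<in> E" using ab(2) x v by (simp add: h_mem)
    then have mem: "(v, x) \<in> E \<inter> (S \<times> B \<union> B \<times> S)" "(x, v) \<in> E \<inter> (S \<times> B \<union> B \<times> S)"
      using symE x v by auto
    show "e \<in> map_prod \<phi> \<phi> ` (E \<inter> (S \<times> B \<union> B \<times> S))"
      using ab(3)
    proof
      assume "e = (Inl a, Inr b)"
      then show ?thesis using x v by (intro image_eqI[OF _ mem(2)]) (simp add: \<phi>S \<phi>B)
    next
      assume "e = (Inr b, Inl a)"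
      then show ?thesis using x v by (intro image_eqI[OF _ mem(1)]) (simp add: \<phi>S \<phi>B)
    qed
  qed
  \<comment> \<open>Arcs are pairs of vertices, so the vertex map induces the arc map and the new
    tail and head are the projections.\<close>
  define hom where "hom = \<lparr>iso_verts = \<phi>, iso_arcs = map_prod \<phi> \<phi>, iso_head = snd, iso_tail = fst\<rparr>"
  have wf: "wf_digraph (with_proj (between_graph G S B))"
    by unfold_locales (auto simp: between_graph_def)
  have "inj_on (map_prod \<phi> \<phi>) (E \<inter> (S \<times> B \<union> B \<times> S))"
    by (rule inj_on_subset[OF map_prod_inj_on[OF inj\<phi> inj\<phi>]]) auto
  then have "pre_digraph.digraph_isomorphism (with_proj (between_graph G S B)) hom"
    using wf inj\<phi> unfolding pre_digraph.digraph_isomorphism_def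
    by (auto simp: hom_def between_graph_def E_def)
  moreover have "with_proj (universal_graph k) = app_iso hom (with_proj (between_graph G S B))"
    unfolding app_iso_def using im\<phi> arcs_eq
    by (simp add: hom_def between_graph_def with_proj_def E_def)
  ultimately show ?thesis unfolding digraph_iso_def by blast
qed

text \<open>Choosing one witness for each subset of a shattered \<open>S\<close> gives exactly
  \<open>2 ^ k\<close> vertices outside \<open>S\<close>, since different traces force different
  witnesses. Together with \<open>S\<close> they form a universal graph.\<close>

lemma shatter_free_if_universal_free:
  assumes G: "pair_graph G" and free: "universal_free k G"
  shows "shatter_free k (pverts G) (parcs G)"
  unfolding shatter_free_def
proof (intro allI impI notI)
  fix S assume S: "S \<subseteq> pverts G" "card S = k"
    and sh: "shatters ((\<lambda>v. parcs G `` {v}) ` (pverts G - S)) S"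
  interpret pair_graph G by (rule G)
  have finS: "finite S" using finite_subset[OF S(1) pair_finite_verts] .
  have "\<exists>v \<in> pverts G - S. parcs G `` {v} \<inter> S = T" if "T \<in> Pow S" for T
    using sh[unfolded shatters_def, rule_format, of T] that by auto
  then obtain f where f: "\<And>T. T \<in> Pow S \<Longrightarrow> f T \<in> pverts G - S \<and> parcs G `` {f T} \<inter> S = T"
    by metis
  define B where "B = f ` Pow S"
  have bij: "bij_betw (\<lambda>v. parcs G `` {v} \<inter> S) B (Pow S)"
    unfolding B_def by (rule bij_betw_byWitness[where f' = f]) (use f in auto)
  have B: "B \<subseteq> pverts G - S" using f by (auto simp: B_def)
  have "card B = 2 ^ k" using bij_betw_same_card[OF bij] finS S(2) by (simp add: card_Pow)
  moreover have "digraph_iso (with_proj (between_graph G S B)) (with_proj (universal_graph k))"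
    by (rule digraph_iso_universal_graph[OF G S B bij])
  ultimately show False
    using free S B unfolding universal_free_def by blast
qed

lemma card_universal_free_graphs_le:
  "card (universal_free_graphs k N) \<le> card (shatter_free_graphs k {..<N})"
proof (rule card_inj_on_le[where f = parcs])
  show "inj_on parcs (universal_free_graphs k N)"
    by (rule inj_onI) (auto simp: universal_free_graphs_def intro: pair_pre_digraph.equality)
  show "parcs ` universal_free_graphs k N \<subseteq> shatter_free_graphs k {..<N}"
  proof
    fix E assume "E \<in> parcs ` universal_free_graphs k N"
    then obtain G where G: "pair_graph G" "pverts G = {..<N}" "universal_free k G" "E = parcs G"
      by (auto simp: universal_free_graphs_def)
    interpret pair_graph G by (rule G)
    have "E \<subseteq> {..<N} \<times> {..<N}" using G(2,4) in_arcsD1 in_arcsD2 by auto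
    moreover have "sym E" using pair_sym_arcs G(4) by (simp add: symmetric_def)
    moreover have "irrefl E" using pair_no_loops G(4) by (fastforce simp: irrefl_def)
    ultimately show "E \<in> shatter_free_graphs k {..<N}"
      using shatter_free_if_universal_free[OF G(1,3)] G(2,4) by (simp add: shatter_free_graphs_def)
  qed
qed (simp add: finite_shatter_free_graphs)

section \<open>The asymptotic bound\<close>

theorem theorem15:
  fixes d :: nat
  assumes "d \<ge> 1"
  shows "\<exists>g :: nat \<Rightarrow> real.
    g \<in> O(\<lambda>N. real N powr (2 - 1 / real d) * ln (real N)) \<and>
    (\<forall>N. real (card (universal_free_graphs (d + 1) N)) \<le> 2 powr g N)"
proof -
  \<comment> \<open>This is the near-twin bound at \<open>N\<close> vertices. The exponent is
    nonnegative for \<open>d \<ge> 1\<close>, so it also covers every smaller graph met during the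
    deletions.\<close>
  define K where "K N = nat \<lfloor>32 * real d * real N powr (1 - 1 / real d)\<rfloor>" for N :: nat
  define g where "g N = real (N * (K N + 3)) * log 2 (real N + 1)" for N
  have d1: "1 / real d \<le> 1" using assms by simp
  have "real (card (universal_free_graphs (d + 1) N)) \<le> 2 powr g N" for N
  proof -
    have "\<exists>u\<in>W. \<exists>v\<in>W. u \<noteq> v \<and> card (separators W E u v) \<le> K N"
      if W: "finite W" "2 \<le> card W" "card W \<le> N" "shatter_free (d + 1) W E" for W :: "nat set" and E
    proof -
      obtain u v where uv: "u \<in> W" "v \<in> W" "u \<noteq> v"
          "real (card (separators W E u v)) \<le> 32 * real d * real (card W) powr (1 - 1 / real d)"
        using exists_near_twins[OF W(1,2) W(4)[unfolded Suc_eq_plus1[symmetric]] assms] by auto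
      have "real (card W) powr (1 - 1 / real d) \<le> real N powr (1 - 1 / real d)"
        using W d1 by (intro powr_mono2) auto
      then have "32 * real d * real (card W) powr (1 - 1 / real d) \<le>
          32 * real d * real N powr (1 - 1 / real d)"
        by (intro mult_left_mono) auto
      then have "card (separators W E u v) \<le> K N"
        using uv(4) unfolding K_def by (simp add: le_nat_iff le_floor_iff)
      then show ?thesis using uv by blast
    qed
    then have "card (shatter_free_graphs (d + 1) {..<N}) \<le> (N + 1) ^ (card {..<N} * (K N + 3))"
      by (intro card_shatter_free_graphs_le[where N = N]) auto
    then have "card (universal_free_graphs (d + 1) N) \<le> (N + 1) ^ (N * (K N + 3))"
      using card_universal_free_graphs_le[of "d + 1" N] by simp
    then have "real (card (universal_free_graphs (d + 1) N)) \<le> real ((N + 1) ^ (N * (K N + 3)))"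
      by (simp only: of_nat_le_iff)
    also have "\<dots> = (real N + 1) powr real (N * (K N + 3))"
      by (subst powr_realpow) (simp_all add: add.commute)
    also have "\<dots> = 2 powr g N"
    proof -
      have "(real N + 1) powr real (N * (K N + 3)) = (2 powr log 2 (real N + 1)) powr real (N * (K N + 3))"
        by simp
      then show ?thesis unfolding g_def powr_powr by (simp only: mult.commute)
    qed
    finally show ?thesis .
  qed
  moreover have "g \<in> O(\<lambda>N. real N powr (2 - 1 / real d) * ln (real N))"
  proof (rule bigoI)
    show "\<forall>\<^sub>F N in sequentially. norm (g N) \<le>
        (32 * real d + 3) * (2 / ln 2) * norm (real N powr (2 - 1 / real d) * ln (real N))"
    proof (rule eventually_sequentiallyI[of 2])
      fix N :: nat assume N: "2 \<le> N"
      define P where "P = real N powr (1 - 1 / real d)"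
      have P1: "P \<ge> 1" using N d1 by (auto simp: P_def intro: ge_one_powr_ge_zero)
      have "real (K N) \<le> 32 * real d * P"
        unfolding K_def P_def by (simp add: of_nat_floor)
      then have K: "real (K N + 3) \<le> (32 * real d + 3) * P"
        using P1 by (simp add: distrib_right)
      have NP: "real N * P = real N powr (2 - 1 / real d)"
      proof -
        have "real N * P = real N powr 1 * P" using N by simp
        also have "\<dots> = real N powr (1 + (1 - 1 / real d))" unfolding P_def powr_add ..
        finally show ?thesis by simp
      qed
      have "real N + 1 \<le> real N ^ 2"
      proof -
        have "2 * real N \<le> real N * real N" using N by (intro mult_right_mono) auto
        then show ?thesis using N unfolding power2_eq_square by linarith
      qed
      then have "ln (real N + 1) \<le> ln (real N ^ 2)" using N by (subst ln_le_cancel_iff) auto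
      also have "\<dots> = 2 * ln (real N)" using N by (simp add: ln_realpow)
      finally have L: "log 2 (real N + 1) \<le> 2 / ln 2 * ln (real N)"
        by (simp add: log_def divide_right_mono)
      have "g N = real N * real (K N + 3) * log 2 (real N + 1)"
        by (simp only: g_def of_nat_mult)
      also have "\<dots> \<le> real N * ((32 * real d + 3) * P) * (2 / ln 2 * ln (real N))"
        using N P1 by (intro mult_mono K L mult_nonneg_nonneg) auto
      also have "\<dots> = (32 * real d + 3) * (2 / ln 2) * (real N * P * ln (real N))"
        by (simp only: mult_ac)
      finally have "g N \<le> (32 * real d + 3) * (2 / ln 2) * (real N powr (2 - 1 / real d) * ln (real N))"
        unfolding NP .
      moreover have "0 \<le> g N" using N by (simp add: g_def)
      moreover have "0 \<le> real N powr (2 - 1 / real d) * ln (real N)" using N by simp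
      ultimately show "norm (g N) \<le>
          (32 * real d + 3) * (2 / ln 2) * norm (real N powr (2 - 1 / real d) * ln (real N))"
        by simp
    qed
  qed
  ultimately show ?thesis by blast
qed

end
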